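(* Let $k,p\ge1$ and let $x_1\dots x_k,\ y_1\dots y_p\in\mathbb{Z}^*$ be words with $x_k\neq y_p$. Let $\overline{\Gamma}_\infty$ be the reduced orbital Schreier graph of $\mathcal{K}(x_1\dots x_k,y_1\dots y_p)$ with respect to the generating set $S=\{a_1,\dots,a_k,b_1,\dots,b_p\}$, and let $u\in\mathbb{Z}^\omega$. Then the connected component of $u$ in $\overline{\Gamma}_\infty$ is $T(u)$, and it is a tree with countably many ends.
   Context: **The group $\mathcal{K}$.** $\mathbb{Z}^*$ is the set of finite words over the alphabet $\mathbb{Z}$, regarded as a rooted tree: the root is the empty word $\emptyset$ and the children of $v$ are the words $vn$, $n\in\mathbb{Z}$. Given words $x_1\dots x_k,\ y_1\dots y_p$ with $x_k\ne y_p$, the kneading automaton has states $a_1,\dots,a_k,b_1,\dots,b_p$ and an identity state $\mathbf{1}$, and transition function $\tau(q,z)=(q(z),q|_z)$ for a state $q$ and $z\in\mathbb{Z}$, given by: $\tau(a_1,z)=(z+1,\mathbf{1})$ for all $z$; $\tau(a_{i+1},x_i)=(x_i,a_i)$ for $1\le i\le k-1$; $\tau(b_1,x_k)=(x_k,a_k)$; $\tau(b_1,y_p)=(y_p,b_p)$; $\tau(b_{j+1},y_j)=(y_j,b_j)$ for $1\le j\le p-1$; and $\tau(q,z)=(z,\mathbf{1})$ in all other cases. Each state acts on $\mathbb{Z}^*$ by a rooted tree automorphism via $q(\emptyset)=\emptyset$, $q(zv)=q(z)\,(q|_z)(v)$ for $z\in\mathbb{Z}$, $v\in\mathbb{Z}^*$.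 $\mathcal{K}(x_1\dots x_k,y_1\dots y_p)$ is the group of automorphisms of $\mathbb{Z}^*$ generated by $a_1,\dots,a_k,b_1,\dots,b_p$. It also acts on the set $\mathbb{Z}^\omega$ of right-infinite words $u=u_1u_2u_3\dots$ over $\mathbb{Z}$ (the ends of $\mathbb{Z}^*$), by letting it act on all finite prefixes. **Schreier graphs.** The orbital Schreier graph $\Gamma_\infty$ has vertex set $\mathbb{Z}^\omega$ and edges $v\to s(v)$ for $v\in\mathbb{Z}^\omega$, $s\in S$. The reduced orbital Schreier graph $\overline{\Gamma}_\infty$ is obtained by deleting all loops. Connectedness, being a tree, and ends refer to the underlying undirected graph. **Subgraphs.** For $u\in\mathbb{Z}^\omega$ and $m\in\mathbb{N}$, $T_m(u)$ is the induced subgraph of $\overline{\Gamma}_\infty$ on the vertex set $\{u'\in\mathbb{Z}^\omega: u_i=u'_i\text{ for all } i>m\}$, and $T(u)=\bigcup_{m\in\mathbb{N}}T_m(u)$. **Ends.** The ends of a tree are the equivalence classes of geodesic rays, two rays being equivalent if they have a common tail. *)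

theory Defs
  imports "Graph_Theory.Graph_Theory" "HOL-Library.Countable_Set"
begin

section \<open>The kneading automaton and its action\<close>

text \<open>
  Finite words over the integers are lists. The words \<open>x\<^sub>1\<dots>x\<^sub>k\<close> and \<open>y\<^sub>1\<dots>y\<^sub>p\<close> are lists
  \<open>xs\<close> and \<open>ys\<close> with \<open>k = length xs\<close> and \<open>p = length ys\<close>; letters and states carry
  the usual indices starting at 1. Only the states \<open>A i\<close> with \<open>1 \<le> i \<le> k\<close> and \<open>B j\<close> with
  \<open>1 \<le> j \<le> p\<close>, together with the identity state, belong to the automaton; the transition
  function is total on the datatype, but never leads from these states to any other.
\<close>

datatype state = Id_State | A nat | B nat

definition letter :: "int list \<Rightarrow> nat \<Rightarrow> int" where
  "letter w i = w ! (i - 1)"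

fun kneading_transition :: "int list \<Rightarrow> int list \<Rightarrow> state \<Rightarrow> int \<Rightarrow> int \<times> state" where
  "kneading_transition xs ys Id_State z = (z, Id_State)"
| "kneading_transition xs ys (A i) z =
     (if i = 1 then (z + 1, Id_State)
      else if z = letter xs (i - 1) then (z, A (i - 1))
      else (z, Id_State))"
| "kneading_transition xs ys (B j) z =
     (if j = 1 then
        (if z = letter xs (length xs) then (z, A (length xs))
         else if z = letter ys (length ys) then (z, B (length ys))
         else (z, Id_State))
      else if z = letter ys (j - 1) then (z, B (j - 1))
      else (z, Id_State))"

fun state_action :: "int list \<Rightarrow> int list \<Rightarrow> state \<Rightarrow> int list \<Rightarrow> int list" where
  "state_action xs ys q [] = []"
| "state_action xs ys q (z # v) =
     (case kneading_transition xs ys q z of (z', q') \<Rightarrow> z' # state_action xs ys q' v)"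

definition kneading_generators :: "int list \<Rightarrow> int list \<Rightarrow> (int list \<Rightarrow> int list) set" where
  "kneading_generators xs ys =
     {state_action xs ys (A i) | i. 1 \<le> i \<and> i \<le> length xs} \<union>
     {state_action xs ys (B j) | j. 1 \<le> j \<and> j \<le> length ys}"

text \<open>
  A right-infinite word \<open>u\<^sub>1u\<^sub>2\<dots>\<close> is a function \<open>u :: nat \<Rightarrow> int\<close> with \<open>u n\<close> standing for the
  letter \<open>u\<^sub>n\<^sub>+\<^sub>1\<close>. A rooted tree automorphism \<open>g\<close> preserves length and prefixes, so the
  letter at position \<open>n\<close> of the image can be read off the image of any longer finite prefix.
\<close>

type_synonym inf_word = "nat \<Rightarrow> int"

definition boundary_action :: "(int list \<Rightarrow> int list) \<Rightarrow> inf_word \<Rightarrow> inf_word" where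
  "boundary_action g u = (\<lambda>n. g (map u [0..<Suc n]) ! n)"


section \<open>Schreier graphs\<close>

text \<open>
  The orbital Schreier graph of a group of tree automorphisms depends only on its generating
  set \<open>S\<close>. It is a directed multigraph: there is one arc \<open>(v, s)\<close>, from \<open>v\<close> to \<open>s(v)\<close>, for each
  vertex \<open>v\<close> and each \<open>s \<in> S\<close>.
\<close>

type_synonym schreier_graph = "(inf_word, inf_word \<times> (int list \<Rightarrow> int list)) pre_digraph"

definition orbital_schreier_graph :: "(int list \<Rightarrow> int list) set \<Rightarrow> schreier_graph" where
  "orbital_schreier_graph S =
     \<lparr> verts = UNIV, arcs = UNIV \<times> S, tail = fst, head = (\<lambda>(v, s). boundary_action s v) \<rparr>"

definition delete_loops :: "('a, 'b) pre_digraph \<Rightarrow> ('a, 'b) pre_digraph" where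
  "delete_loops G = G \<lparr> arcs := {e \<in> arcs G. tail G e \<noteq> head G e} \<rparr>"

definition kneading_schreier_graph :: "int list \<Rightarrow> int list \<Rightarrow> schreier_graph" where
  "kneading_schreier_graph xs ys =
     delete_loops (orbital_schreier_graph (kneading_generators xs ys))"

definition T_level :: "int list \<Rightarrow> int list \<Rightarrow> nat \<Rightarrow> inf_word \<Rightarrow> schreier_graph" where
  "T_level xs ys m u = kneading_schreier_graph xs ys \<restriction> {u'. \<forall>i\<ge>m. u i = u' i}"

definition T_graph :: "int list \<Rightarrow> int list \<Rightarrow> inf_word \<Rightarrow> schreier_graph" where
  "T_graph xs ys u =
     pre_digraph.Union (kneading_schreier_graph xs ys) (range (\<lambda>m. T_level xs ys m u))"


section \<open>Components, trees and ends of the underlying undirected graph\<close>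

definition component_of :: "('a, 'b) pre_digraph \<Rightarrow> 'a \<Rightarrow> ('a, 'b) pre_digraph" where
  "component_of G u = G \<restriction> {v. u \<rightarrow>\<^sup>*\<^bsub>with_proj (mk_symmetric G)\<^esub> v}"

text \<open>
  The predicates \<open>forest\<close> and \<open>tree\<close> of the graph library only exclude directed cycles, so they
  do not express that the underlying undirected graph is a tree. The cycles below run
  through vertices \<open>v\<^sub>0, \<dots>, v\<^sub>n\<^sub>-\<^sub>1\<close> and arcs \<open>e\<^sub>0, \<dots>, e\<^sub>n\<^sub>-\<^sub>1\<close> with \<open>e\<^sub>i\<close> joining \<open>v\<^sub>i\<close>
  and \<open>v\<^sub>i\<^sub>+\<^sub>1\<close> (indices modulo \<open>n\<close>) in either direction. The underlying graph is
  taken as a multigraph, so a loop (\<open>n = 1\<close>) and a pair of parallel or opposite arcs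
  (\<open>n = 2\<close>) count as cycles.
\<close>

definition undirected_cycle :: "('a, 'b) pre_digraph \<Rightarrow> 'a list \<Rightarrow> 'b list \<Rightarrow> bool" where
  "undirected_cycle G vs es \<longleftrightarrow>
     es \<noteq> [] \<and> length vs = length es \<and> distinct vs \<and> distinct es \<and> set es \<subseteq> arcs G \<and>
     (\<forall>i < length es. {tail G (es ! i), head G (es ! i)} = {vs ! i, vs ! (Suc i mod length es)})"

definition undirected_tree :: "('a, 'b) pre_digraph \<Rightarrow> bool" where
  "undirected_tree G \<longleftrightarrow> connected G \<and> \<not> (\<exists>vs es. undirected_cycle G vs es)"

text \<open>The distance is meaningful only for vertices in the same component.\<close>

definition undirected_distance :: "('a, 'b) pre_digraph \<Rightarrow> 'a \<Rightarrow> 'a \<Rightarrow> nat" where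
  "undirected_distance G v w = (LEAST n. (v, w) \<in> parcs (mk_symmetric G) ^^ n)"

definition geodesic_ray :: "('a, 'b) pre_digraph \<Rightarrow> (nat \<Rightarrow> 'a) \<Rightarrow> bool" where
  "geodesic_ray G r \<longleftrightarrow>
     (\<forall>i. (r i, r (Suc i)) \<in> parcs (mk_symmetric G)) \<and>
     (\<forall>i j. i \<le> j \<longrightarrow> undirected_distance G (r i) (r j) = j - i)"

definition common_tail :: "(nat \<Rightarrow> 'a) \<Rightarrow> (nat \<Rightarrow> 'a) \<Rightarrow> bool" where
  "common_tail r s \<longleftrightarrow> (\<exists>m n. \<forall>i. r (m + i) = s (n + i))"

definition tree_ends :: "('a, 'b) pre_digraph \<Rightarrow> (nat \<Rightarrow> 'a) set set" where
  "tree_ends G =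
     {r. geodesic_ray G r} //
     {(r, s). geodesic_ray G r \<and> geodesic_ray G s \<and> common_tail r s}"

end

theory Submission
  imports Defs
begin

text \<open>
  The edges of the Schreier graph have a simple description. Put
  \<open>c = x\<^sub>1\<dots>x\<^sub>k(y\<^sub>1\<dots>y\<^sub>p)\<^sup>\<omega>\<close> and let \<open>w\<^sub>n\<close> be the first \<open>n\<close> letters of \<open>c\<close> in reverse
  order. Following the automaton from a generator down to \<open>a\<^sub>1\<close>, one reads one of the words \<open>w\<^sub>n\<close>;
  each \<open>w\<^sub>n\<close> belongs to exactly one generator, and that generator sends \<open>w\<^sub>nzt\<close> to
  \<open>w\<^sub>n(z+1)t\<close>. Everything else is fixed (\<open>boundary_action_level_state\<close>,
  \<open>boundary_action_moves\<close>). So the edges of the reduced graph are exactly the pairs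
  \<open>w\<^sub>nzt \<midarrow> w\<^sub>n(z+1)t\<close>, one arc each; \<open>n\<close> is called the level of the edge.

  Component. An edge changes a single letter, so components lie inside cofinality classes. Conversely,
  the words that agree from position \<open>m\<close> on form a connected set, by induction on \<open>m\<close>: a block for
  \<open>m + 1\<close> is a line of blocks for \<open>m\<close>, joined at \<open>w\<^sub>m\<close>.

  Tree. Between two consecutive passages of its highest level \<open>M\<close>, a walk changes no letter from
  \<open>M\<close> on and starts and ends at the prefix \<open>w\<^sub>M\<close>, so it returns to the same vertex. A reduced
  walk hence cannot undo what it did to letter \<open>M\<close>, and cannot be closed
  (\<open>no_closed_reduced_walk\<close>).

  Ends. If the levels along a ray are bounded, the same observation shows that the ray ends in a
  straight line on which a single letter moves (\<open>bounded_ray_straight\<close>); a cofinality class is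
  countable, so there are countably many such ends. A ray with unbounded levels leaves every block
  around \<open>u\<close>. Here the form of \<open>c\<close> enters: an exit of level \<open>n\<close> from the block for \<open>m\<close>
  means that \<open>w\<^sub>n\<^sub>-\<^sub>m\<close> is a prefix of \<open>u\<^sub>m\<^sub>+\<^sub>1u\<^sub>m\<^sub>+\<^sub>2\<dots>\<close>, and since \<open>x\<^sub>k \<noteq> y\<^sub>p\<close> the prefix determines
  \<open>n - m\<close> up to \<open>k + p\<close> possibilities (\<open>same_colour_reads_unique\<close>). Two rays that use
  the same exits infinitely often have a common tail, so there are at most \<open>k + p\<close> ends of this kind
  (\<open>finite_unbounded_ends\<close>). Finally, the lines on which only the first letter moves already
  give infinitely many ends.
\<close>


section \<open>Reduced walks\<close>

definition reduced_walk :: "('a \<Rightarrow> 'a \<Rightarrow> bool) \<Rightarrow> (nat \<Rightarrow> 'a) \<Rightarrow> nat \<Rightarrow> bool" where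
  "reduced_walk E p n \<longleftrightarrow>
     (\<forall>i<n. E (p i) (p (Suc i))) \<and> (\<forall>i. Suc (Suc i) \<le> n \<longrightarrow> p i \<noteq> p (Suc (Suc i)))"

lemma reduced_walk_segment:
  assumes "reduced_walk E p n" and "i + l \<le> n"
  shows "reduced_walk E (\<lambda>j. p (i + j)) l"
  unfolding reduced_walk_def
proof (intro conjI allI impI)
  show "E (p (i + j)) (p (i + Suc j))" if "j < l" for j
    using assms that by (auto simp: reduced_walk_def)
  show "p (i + j) \<noteq> p (i + Suc (Suc j))" if "Suc (Suc j) \<le> l" for j
    using assms that by (auto simp: reduced_walk_def)
qed

text \<open>If two reduced walks with common endpoints have different first steps, then going back along
  one and out along the other is a closed reduced walk; equal first steps are removed by induction.\<close>

lemma reduced_walk_unique: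
  assumes sym: "\<And>v w. E v w \<Longrightarrow> E w v"
    and no_closed: "\<And>p n. reduced_walk E p n \<Longrightarrow> 0 < n \<Longrightarrow> p 0 \<noteq> p n"
    and "reduced_walk E p m" and "reduced_walk E q n"
    and "p 0 = q 0" and "p m = q n"
  shows "m = n \<and> (\<forall>i\<le>m. p i = q i)"
  using assms(3-)
proof (induction m arbitrary: p q n)
  case 0
  then have "n = 0"
    using no_closed[of q n] by fastforce
  then show ?case
    using 0 by simp
next
  case (Suc m)
  have "n \<noteq> 0"
    using no_closed[OF Suc.prems(1)] Suc.prems(3,4) by (metis zero_less_Suc)
  then obtain k where n: "n = Suc k"
    using not0_implies_Suc by blast
  show ?case
  proof (cases "p 1 = q 1")
    case True
    have tl: "reduced_walk E (\<lambda>j. p (1 + j)) m" "reduced_walk E (\<lambda>j. q (1 + j)) k"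
      by (rule reduced_walk_segment[OF Suc.prems(1)] reduced_walk_segment[OF Suc.prems(2)],
          use n in simp)+
    have "m = k \<and> (\<forall>i\<le>m. p (1 + i) = q (1 + i))"
      by (rule Suc.IH[OF tl]) (use True Suc.prems(4) n in auto)
    then have "p i = q i" if "i \<le> Suc m" for i
      using that Suc.prems(3) by (cases i) auto
    then show ?thesis
      using n \<open>m = k \<and> _\<close> by blast
  next
    case False
    define h where "h i = (if i \<le> Suc m then p (Suc m - i) else q (i - Suc m))" for i
    have hq: "h i = q (i - Suc m)" if "Suc m \<le> i" for i
      using that Suc.prems(3) by (auto simp: h_def)
    have "E (h i) (h (Suc i))" if "i < Suc m + n" for i
    proof (cases "i < Suc m")
      case True
      then have "E (p (m - i)) (p (Suc (m - i)))"
        using Suc.prems(1) by (auto simp: reduced_walk_def)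
      then show ?thesis
        using sym True by (simp add: h_def Suc_diff_le)
    next
      case False
      then have "E (q (i - Suc m)) (q (Suc (i - Suc m)))"
        using Suc.prems(2) that by (auto simp: reduced_walk_def)
      moreover have "Suc (i - Suc m) = i - m"
        using False by simp
      ultimately show ?thesis
        using False by (simp add: hq)
    qed
    moreover have "h i \<noteq> h (Suc (Suc i))" if "Suc (Suc i) \<le> Suc m + n" for i
    proof -
      consider "Suc (Suc i) \<le> Suc m" | "i = m" | "Suc m \<le> i"
        by linarith
      then show ?thesis
      proof cases
        case 1
        then have "p (m - Suc i) \<noteq> p (Suc (Suc (m - Suc i)))"
          using Suc.prems(1) by (auto simp: reduced_walk_def)
        moreover have "Suc (Suc (m - Suc i)) = Suc m - i"
          using 1 by simp
        ultimately show ?thesis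
          using 1 by (auto simp: h_def)
      next
        case 2
        then show ?thesis
          using False by (simp add: h_def)
      next
        case 3
        then have "q (i - Suc m) \<noteq> q (Suc (Suc (i - Suc m)))"
          using Suc.prems(2) that by (auto simp: reduced_walk_def)
        moreover have "Suc (Suc (i - Suc m)) = Suc i - m"
          using 3 by simp
        ultimately show ?thesis
          using 3 by (simp add: hq)
      qed
    qed
    ultimately have "reduced_walk E h (Suc m + n)"
      by (simp add: reduced_walk_def)
    then have "h 0 \<noteq> h (Suc m + n)"
      using no_closed by simp
    then show ?thesis
      using Suc.prems(4) by (simp add: hq) (simp add: h_def)
  qed
qed

text \<open>Between any two common vertices the rays agree, so the shift between their parameters is the one
  found at the first meeting.\<close>

lemma rays_meeting_infinitely_often_common_tail:
  assumes unique: "\<And>p m q n. reduced_walk E p m \<Longrightarrow> reduced_walk E q n \<Longrightarrow> p 0 = q 0 \<Longrightarrow>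
      p m = q n \<Longrightarrow> m = n \<and> (\<forall>i\<le>m. p i = q i)"
    and r: "\<And>n. reduced_walk E r n" and s: "\<And>n. reduced_walk E s n"
    and meet: "\<And>N. \<exists>i\<ge>N. \<exists>j\<ge>N. r i = s j"
  shows "common_tail r s"
proof -
  obtain i j where ij: "r i = s j"
    using meet by blast
  have "r (i + l) = s (j + l)" for l
  proof -
    obtain i' j' where ij': "i' \<ge> i + j + l" "j' \<ge> i + j + l" "r i' = s j'"
      using meet by blast
    have "i' - i = j' - j \<and> (\<forall>l\<le>i' - i. r (i + l) = s (j + l))"
      using unique[of "\<lambda>l. r (i + l)" "i' - i" "\<lambda>l. s (j + l)" "j' - j"]
        reduced_walk_segment[OF r order_refl] reduced_walk_segment[OF s order_refl] ij ij'
      by simp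
    then show ?thesis
      using ij' by auto
  qed
  then show ?thesis
    unfolding common_tail_def by blast
qed


section \<open>The graph of a letter sequence\<close>

text \<open>The tree property holds for the graph built from any sequence \<open>c\<close>. Positions in infinite words and
  in \<open>c\<close> start at 0. In \<open>reads c n v\<close> the first \<open>n\<close> letters of \<open>v\<close> are
  \<open>c (n - 1), \<dots>, c 0\<close>: the automaton reaches \<open>a\<^sub>1\<close> last, so the sequence is met in reverse.\<close>

definition reads :: "(nat \<Rightarrow> int) \<Rightarrow> nat \<Rightarrow> inf_word \<Rightarrow> bool" where
  "reads c n v \<longleftrightarrow> (\<forall>i<n. v i = c (n - 1 - i))"

definition level_edge :: "(nat \<Rightarrow> int) \<Rightarrow> nat \<Rightarrow> inf_word \<Rightarrow> inf_word \<Rightarrow> bool" where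
  "level_edge c n v w \<longleftrightarrow> reads c n v \<and> (\<exists>d. \<bar>d\<bar> = 1 \<and> w = v(n := v n + d))"

definition level_adj :: "(nat \<Rightarrow> int) \<Rightarrow> inf_word \<Rightarrow> inf_word \<Rightarrow> bool" where
  "level_adj c v w \<longleftrightarrow> (\<exists>n. level_edge c n v w)"

lemma reads_upd: "reads c n (v(n := z)) \<longleftrightarrow> reads c n v"
  by (simp add: reads_def)

lemma level_edge_sym: "level_edge c n v w \<Longrightarrow> level_edge c n w v"
proof -
  assume "level_edge c n v w"
  then obtain d where d: "reads c n v" "\<bar>d\<bar> = 1" "w = v(n := v n + d)"
    by (auto simp: level_edge_def)
  then have "reads c n w \<and> \<bar>- d\<bar> = 1 \<and> v = w(n := w n + - d)"
    by (simp add: reads_upd)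
  then show ?thesis
    unfolding level_edge_def by blast
qed

lemma level_adj_sym: "level_adj c v w \<Longrightarrow> level_adj c w v"
  unfolding level_adj_def using level_edge_sym by blast

lemma level_edge_readsD:
  assumes "level_edge c n v w"
  shows "reads c n v" "reads c n w"
  using assms level_edge_sym[OF assms] by (simp_all add: level_edge_def)

lemma level_edge_other: "level_edge c n v w \<Longrightarrow> i \<noteq> n \<Longrightarrow> w i = v i"
  by (auto simp: level_edge_def)

lemma level_edge_at: "level_edge c n v w \<Longrightarrow> \<bar>w n - v n\<bar> = 1"
  unfolding level_edge_def by force

lemma level_edge_unique: "level_edge c n v w \<Longrightarrow> level_edge c m v w \<Longrightarrow> m = n"
  using level_edge_at[of c n v w] level_edge_other[of c m v w n]
  by (cases "n = m") auto

lemma walk_below_fixed: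
  assumes "\<And>l. i \<le> l \<Longrightarrow> l < j \<Longrightarrow> \<exists>n<M. level_edge c n (p l) (p (Suc l))"
    and "i \<le> j" and "M \<le> a"
  shows "p j a = p i a"
  using assms(2,1)
proof (induction j rule: dec_induct)
  case (step k)
  obtain n where "n < M" "level_edge c n (p k) (p (Suc k))"
    using step by auto
  then show ?case
    using step level_edge_other[of c n "p k" "p (Suc k)" a] assms(3) by auto
qed simp

text \<open>Below level \<open>M\<close> a walk cannot change the letters from position \<open>M\<close> on, and
  \<open>reads c M\<close> prescribes all the others: each block of words that agree from position \<open>M\<close> on
  has only one vertex where a level-\<open>M\<close> edge can be entered or left.\<close>

lemma walk_below_returns:
  assumes "\<And>l. i \<le> l \<Longrightarrow> l < j \<Longrightarrow> \<exists>n<M. level_edge c n (p l) (p (Suc l))"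
    and "i \<le> j" and "reads c M (p i)" and "reads c M (p j)"
  shows "p i = p j"
proof
  fix a
  show "p i a = p j a"
  proof (cases "a < M")
    case True
    then show ?thesis
      using assms(3,4) by (simp add: reads_def)
  next
    case False
    then show ?thesis
      using walk_below_fixed[of i j M c p a] assms(1,2) by simp
  qed
qed

text \<open>The tree property. On a closed walk the letter at the highest level \<open>M\<close> used must go both
  up and down. Two consecutive level-\<open>M\<close> steps in opposite directions bound a closed subwalk, which is
  either empty, so that the walk backtracks, or a shorter counterexample.\<close>

lemma no_closed_reduced_walk:
  "reduced_walk (level_adj c) p n \<Longrightarrow> 0 < n \<Longrightarrow> p 0 \<noteq> p n"
proof (induction n arbitrary: p rule: less_induct)
  case (less n)
  show ?case
  proof
    assume closed: "p 0 = p n"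
    have "\<forall>i. \<exists>m. i < n \<longrightarrow> level_edge c m (p i) (p (Suc i))"
      using less.prems(1) by (auto simp: reduced_walk_def level_adj_def)
    then obtain lev where lev: "\<And>i. i < n \<Longrightarrow> level_edge c (lev i) (p i) (p (Suc i))"
      by metis
    define M where "M = Max (lev ` {..<n})"
    have le_M: "lev i \<le> M" if "i < n" for i
      unfolding M_def using that by (intro Max_ge) auto
    have "M \<in> lev ` {..<n}"
      unfolding M_def using less.prems(2) by (intro Max_in) auto
    then have ex_M: "\<exists>i. i < n \<and> lev i = M"
      by blast
    define d where "d i = p (Suc i) M - p i M" for i
    have d_M: "\<bar>d i\<bar> = 1" if "i < n" "lev i = M" for i
      using level_edge_at[OF lev] that unfolding d_def by metis
    have d_0: "d i = 0" if "i < n" "lev i \<noteq> M" for i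
      using level_edge_other[OF lev] that unfolding d_def by simp
    define i0 where "i0 = (LEAST i. i < n \<and> lev i = M)"
    have i0: "i0 < n" "lev i0 = M"
      using LeastI_ex[OF ex_M] by (auto simp: i0_def)
    have sum0: "(\<Sum>i<n. d i) = 0"
      unfolding d_def using sum_lessThan_telescope[of "\<lambda>i. p i M" n] closed by simp
    have ex_j: "\<exists>j. j < n \<and> lev j = M \<and> d j \<noteq> d i0"
    proof (rule ccontr)
      assume "\<not> ?thesis"
      then have all: "d j = (if lev j = M then d i0 else 0)" if "j < n" for j
        using that d_0 by auto
      have "(\<Sum>i<n. d i) = (\<Sum>i<n. if lev i = M then d i0 else 0)"
        by (intro sum.cong) (use all in auto)
      also have "\<dots> = int (card {i\<in>{..<n}. lev i = M}) * d i0"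
        by (simp flip: sum.inter_filter)
      finally have "card {i\<in>{..<n}. lev i = M} = 0"
        using sum0 d_M[OF i0] by auto
      then show False
        using i0 by auto
    qed
    define j where "j = (LEAST j. j < n \<and> lev j = M \<and> d j \<noteq> d i0)"
    have j: "j < n" "lev j = M" "d j \<noteq> d i0"
      using LeastI_ex[OF ex_j] by (auto simp: j_def)
    have j_least: "d l = d i0" if "l < j" "lev l = M" for l
      using not_less_Least[of l "\<lambda>j. j < n \<and> lev j = M \<and> d j \<noteq> d i0"] that j(1) by (auto simp: j_def)
    have "i0 \<noteq> j"
      using j(3) by blast
    moreover have "i0 \<le> j"
      unfolding i0_def by (rule Least_le) (use j in blast)
    ultimately have "i0 \<in> {l. l < j \<and> lev l = M}"
      using i0 by simp
    define i where "i = Max {l. l < j \<and> lev l = M}"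
    have "i \<in> {l. l < j \<and> lev l = M}"
      unfolding i_def using \<open>i0 \<in> _\<close> by (intro Max_in) auto
    then have i: "i < j" "lev i = M" "d i = d i0"
      using j_least by auto
    have below: "lev l < M" if "Suc i \<le> l" "l < j" for l
    proof -
      have "lev l \<noteq> M"
      proof
        assume "lev l = M"
        then have "l \<le> i"
          unfolding i_def using that by (intro Max_ge) auto
        then show False
          using that by simp
      qed
      then show ?thesis
        using le_M[of l] that j by simp
    qed
    have same: "p (Suc i) = p j"
    proof (rule walk_below_returns)
      show "\<exists>n<M. level_edge c n (p l) (p (Suc l))" if "Suc i \<le> l" "l < j" for l
        using below[OF that] lev[of l] that j(1) by auto
      show "reads c M (p (Suc i))" "reads c M (p j)"
        using level_edge_readsD[OF lev] i j by (metis less_trans)+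
    qed (use i in simp)
    show False
    proof (cases "j = Suc i")
      case True
      have "p i \<noteq> p (Suc (Suc i))"
        using less.prems(1) j True by (auto simp: reduced_walk_def)
      moreover have "p i a = p (Suc (Suc i)) a" for a
      proof (cases "a = M")
        case eq: True
        have "\<bar>d i\<bar> = 1" "\<bar>d j\<bar> = 1" "d i \<noteq> d j"
          using d_M[of i] d_M[of j] i j by auto
        moreover have "d j = p (Suc (Suc i)) M - p (Suc i) M" "d i = p (Suc i) M - p i M"
          by (simp_all add: d_def True)
        ultimately show ?thesis
          unfolding eq by linarith
      next
        case False
        then show ?thesis
          using level_edge_other[OF lev[of i], of a] level_edge_other[OF lev[of j], of a] i j
          unfolding True by simp
      qed
      ultimately show False
        by blast
    next
      case False
      then have "reduced_walk (level_adj c) (\<lambda>l. p (Suc i + l)) (j - Suc i)"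
        by (intro reduced_walk_segment[OF less.prems(1)]) (use i j in simp)
      moreover have "j - Suc i < n" "0 < j - Suc i" "Suc i + (j - Suc i) = j"
        using False i j by simp_all
      ultimately have "p (Suc i + 0) \<noteq> p j"
        using less.IH by metis
      then show False
        using same by simp
    qed
  qed
qed

lemma level_walk_unique:
  assumes "reduced_walk (level_adj c) p m" and "reduced_walk (level_adj c) q n"
    and "p 0 = q 0" and "p m = q n"
  shows "m = n \<and> (\<forall>i\<le>m. p i = q i)"
  using level_adj_sym no_closed_reduced_walk assms by (rule reduced_walk_unique)


section \<open>Cofinal words are connected\<close>

definition agree_from :: "nat \<Rightarrow> inf_word \<Rightarrow> inf_word \<Rightarrow> bool" where
  "agree_from m v w \<longleftrightarrow> (\<forall>i\<ge>m. v i = w i)"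

definition cofinal_words :: "inf_word \<Rightarrow> inf_word \<Rightarrow> bool" where
  "cofinal_words v w \<longleftrightarrow> (\<exists>m. agree_from m v w)"

lemma agree_from_mono: "agree_from m v w \<Longrightarrow> m \<le> n \<Longrightarrow> agree_from n v w"
  by (simp add: agree_from_def)

lemma cofinal_refl: "cofinal_words v v"
  by (auto simp: cofinal_words_def agree_from_def)

lemma cofinal_sym: "cofinal_words v w \<Longrightarrow> cofinal_words w v"
  unfolding cofinal_words_def agree_from_def by metis

lemma cofinal_trans: "cofinal_words u v \<Longrightarrow> cofinal_words v w \<Longrightarrow> cofinal_words u w"
proof -
  assume "cofinal_words u v" "cofinal_words v w"
  then obtain m n where "agree_from m u v" "agree_from n v w"
    by (auto simp: cofinal_words_def)
  then have "agree_from (max m n) u w"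
    by (simp add: agree_from_def)
  then show ?thesis
    by (auto simp: cofinal_words_def)
qed

lemma level_edge_agree_from: "level_edge c n v w \<Longrightarrow> agree_from (Suc n) v w"
  using level_edge_other by (fastforce simp: agree_from_def)

lemma level_adj_cofinal: "level_adj c v w \<Longrightarrow> cofinal_words v w"
  unfolding cofinal_words_def level_adj_def using level_edge_agree_from by blast

lemma countable_cofinal: "countable {v. cofinal_words u v}"
proof (rule countable_subset)
  show "{v. cofinal_words u v} \<subseteq> range (\<lambda>xs :: int list. \<lambda>i. if i < length xs then xs ! i else u i)"
  proof
    fix v
    assume "v \<in> {v. cofinal_words u v}"
    then obtain m where "agree_from m u v"
      by (auto simp: cofinal_words_def)
    then have "v = (\<lambda>i. if i < length (map v [0..<m]) then map v [0..<m] ! i else u i)"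
      by (auto simp: agree_from_def fun_eq_iff)
    then show "v \<in> range (\<lambda>xs :: int list. \<lambda>i. if i < length xs then xs ! i else u i)"
      by blast
  qed
qed simp

lemma level_line_connected:
  assumes "reads c m v" and "\<bar>d\<bar> = 1"
  shows "(level_adj c)\<^sup>*\<^sup>* v (v(m := v m + d * int l))"
proof (induction l)
  case (Suc l)
  let ?w = "v(m := v m + d * int l)" and ?w' = "v(m := v m + d * int (Suc l))"
  have "?w' = ?w(m := ?w m + d)"
    by (simp add: algebra_simps)
  then have "level_edge c m ?w ?w'"
    unfolding level_edge_def using assms reads_upd by blast
  then show ?case
    using Suc rtranclp.rtrancl_into_rtrancl level_adj_def by metis
qed simp

text \<open>Connectedness by induction on the length \<open>m\<close> of the differing prefix: go to the only vertex of
  the block where level \<open>m\<close> can be entered, along the level-\<open>m\<close> line, and then inside the target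
  block.\<close>

lemma agree_from_connected:
  "agree_from m v w \<Longrightarrow> (level_adj c)\<^sup>*\<^sup>* v w"
proof (induction m arbitrary: v w)
  case 0
  then have "v = w"
    by (auto simp: agree_from_def)
  then show ?case
    by simp
next
  case (Suc m)
  define gate where "gate x = (\<lambda>i. if i < m then c (m - 1 - i) else x i)" for x :: inf_word
  have "reads c m (gate v)"
    by (simp add: gate_def reads_def)
  have "gate w = (gate v)(m := w m)"
    using Suc.prems by (auto simp: gate_def agree_from_def fun_eq_iff)
  moreover have "(level_adj c)\<^sup>*\<^sup>* (gate v) ((gate v)(m := w m))"
  proof (cases "v m \<le> w m")
    case True
    then show ?thesis
      using level_line_connected[OF \<open>reads c m (gate v)\<close>, of 1 "nat (w m - v m)"]
      by (simp add: gate_def)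
  next
    case False
    then show ?thesis
      using level_line_connected[OF \<open>reads c m (gate v)\<close>, of "-1" "nat (v m - w m)"]
      by (simp add: gate_def)
  qed
  moreover have "(level_adj c)\<^sup>*\<^sup>* v (gate v)" "(level_adj c)\<^sup>*\<^sup>* (gate w) w"
    using Suc.IH by (auto simp: agree_from_def gate_def)
  ultimately show ?case
    by (metis rtranclp_trans)
qed


section \<open>Ends\<close>

text \<open>If the levels of a ray are bounded, some level \<open>M\<close> is the highest one used infinitely often. Once no higher
  level occurs, two consecutive level-\<open>M\<close> steps must be adjacent, since the vertex between them would
  otherwise be visited twice. So the ray ends up on a line on which only letter \<open>M\<close> moves.\<close>

lemma bounded_ray_straight:
  assumes inj: "inj r"
    and lev: "\<And>i. level_edge c (lev i) (r i) (r (Suc i))"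
    and bounded: "\<And>i. lev i \<le> L"
  shows "\<exists>i0 M d. \<bar>d\<bar> = 1 \<and> (\<forall>l. r (i0 + l) = (r i0)(M := r i0 M + d * int l))"
proof -
  define Is where "Is = {m. infinite {i. lev i = m}}"
  have Is_B: "Is \<subseteq> {..L}"
  proof
    fix m
    assume "m \<in> Is"
    then obtain i where "lev i = m"
      unfolding Is_def using not_finite_existsD by blast
    then show "m \<in> {..L}"
      using bounded by auto
  qed
  then have fin: "finite Is"
    using finite_subset by blast
  have "\<exists>m\<in>{..L}. infinite {i\<in>UNIV. lev i = m}"
    using pigeonhole_infinite[of UNIV lev] bounded
    by (metis (no_types, lifting) atMost_iff finite_atMost finite_subset image_subsetI infinite_UNIV_nat
        Collect_cong UNIV_I)
  then have ne: "Is \<noteq> {}"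
    by (auto simp: Is_def)
  define M where "M = Max Is"
  have "M \<in> Is"
    unfolding M_def using fin ne by (rule Max_in)
  have "finite {i. lev i = m}" if "M < m" for m
    using that Max_ge[OF fin, of m] by (force simp: M_def Is_def)
  then have "finite (\<Union>m\<in>{M<..L}. {i. lev i = m})"
    by simp
  moreover have "{i. M < lev i} \<subseteq> (\<Union>m\<in>{M<..L}. {i. lev i = m})"
    using bounded by auto
  ultimately have "finite {i. M < lev i}"
    using finite_subset by blast
  then obtain N where N: "\<And>i. M < lev i \<Longrightarrow> i < N"
    using finite_nat_set_iff_bounded by auto
  have later: "\<exists>j>i. lev j = M" for i
    using \<open>M \<in> Is\<close> by (auto simp: Is_def infinite_nat_iff_unbounded)
  obtain i0 where i0: "N < i0" "lev i0 = M"
    using later by blast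
  have lev_M: "lev (i0 + l) = M" for l
  proof (induction l)
    case (Suc l)
    define i where "i = i0 + l"
    have i: "lev i = M" "N < i"
      using Suc i0 by (auto simp: i_def)
    define j where "j = (LEAST j. i < j \<and> lev j = M)"
    have j: "i < j" "lev j = M"
      using LeastI_ex[OF later[of i]] by (auto simp: j_def)
    have least: "lev l \<noteq> M" if "i < l" "l < j" for l
      using not_less_Least[of l "\<lambda>j. i < j \<and> lev j = M"] that by (auto simp: j_def)
    have "r (Suc i) = r j"
    proof (rule walk_below_returns)
      show "\<exists>n<M. level_edge c n (r l) (r (Suc l))" if "Suc i \<le> l" "l < j" for l
      proof -
        have "lev l < M"
          using least[of l] N[of l] that i by fastforce
        then show ?thesis
          using lev by blast
      qed
      show "reads c M (r (Suc i))" "reads c M (r j)"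
        using level_edge_readsD[OF lev] i j by metis+
    qed (use j in simp)
    then have "j = Suc i"
      using inj by (simp add: inj_eq)
    then show ?case
      using j by (simp add: i_def)
  qed (simp add: i0)
  define d where "d = r (Suc i0) M - r i0 M"
  have d1: "\<bar>d\<bar> = 1"
    using level_edge_at[OF lev[of i0]] lev_M[of 0] by (simp add: d_def)
  have next_upd: "r (Suc (i0 + l)) = (r (i0 + l))(M := r (Suc (i0 + l)) M)" for l
    using level_edge_other[OF lev[of "i0 + l"]] lev_M[of l] by auto
  have dl: "r (Suc (i0 + l)) M - r (i0 + l) M = d" for l
  proof (induction l)
    case (Suc l)
    let ?a = "r (i0 + l) M" and ?b = "r (Suc (i0 + l)) M" and ?c = "r (Suc (Suc (i0 + l))) M"
    have "\<bar>?c - ?b\<bar> = 1"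
      using level_edge_at[OF lev[of "i0 + Suc l"]] lev_M[of "Suc l"] by simp
    moreover have "?c \<noteq> ?a"
    proof
      assume "?c = ?a"
      then have "r (Suc (Suc (i0 + l))) = r (i0 + l)"
        using next_upd[of l] next_upd[of "Suc l"] by (metis add_Suc_right fun_upd_triv fun_upd_upd)
      then show False
        using inj by (simp add: inj_eq)
    qed
    ultimately show ?case
      using Suc d1 by auto
  qed (simp add: d_def)
  have "r (i0 + l) = (r i0)(M := r i0 M + d * int l)" for l
  proof (induction l)
    case (Suc l)
    have "r (i0 + Suc l) = (r (i0 + l))(M := r (i0 + l) M + d)"
      using next_upd[of l] dl[of l] by (simp add: algebra_simps)
    then show ?case
      by (auto simp: Suc algebra_simps)
  qed simp
  then show ?thesis
    using d1 by blast
qed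

text \<open>The exit is the first step of level at least \<open>m\<close>: until then no letter from position \<open>m\<close> on has
  changed.\<close>

lemma unbounded_ray_exits:
  assumes lev: "\<And>i. level_edge c (lev i) (r i) (r (Suc i))"
    and unbounded: "\<And>L. \<exists>i. L < lev i"
    and "agree_from m u (r 0)"
  shows "\<exists>i n. m \<le> n \<and> level_edge c n (r i) (r (Suc i)) \<and> agree_from m u (r i)"
proof -
  have ex: "\<exists>i. m \<le> lev i"
    using unbounded less_imp_le by blast
  define i where "i = (LEAST i. m \<le> lev i)"
  have i: "m \<le> lev i"
    using LeastI_ex[OF ex] by (simp add: i_def)
  have "lev l < m" if "l < i" for l
    using not_less_Least[of l "\<lambda>i. m \<le> lev i"] that by (simp add: i_def)
  then have "r i a = r 0 a" if "m \<le> a" for a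
    using walk_below_fixed[of 0 i m c r a] lev that by blast
  then have "agree_from m u (r i)"
    using assms(3) by (simp add: agree_from_def)
  then show ?thesis
    using i lev by blast
qed

text \<open>Pairwise eventually different functions into a set of \<open>K\<close> colours: at a late enough
  argument all of any \<open>K + 1\<close> of them would have different values.\<close>

lemma finite_eventually_different:
  fixes f :: "'a \<Rightarrow> nat \<Rightarrow> nat"
  assumes bound: "\<And>r. r \<in> D \<Longrightarrow> \<forall>\<^sub>F m in sequentially. f r m < K"
    and diff: "\<And>r s. r \<in> D \<Longrightarrow> s \<in> D \<Longrightarrow> r \<noteq> s \<Longrightarrow> \<forall>\<^sub>F m in sequentially. f r m \<noteq> f s m"
  shows "finite D"
proof (rule ccontr)
  assume "infinite D"
  then obtain D' where D': "finite D'" "card D' = Suc K" "D' \<subseteq> D"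
    using infinite_arbitrarily_large by blast
  have "\<forall>\<^sub>F m in sequentially. \<forall>r\<in>D'. f r m < K \<and> (\<forall>s\<in>D'. r \<noteq> s \<longrightarrow> f r m \<noteq> f s m)"
  proof (intro eventually_ball_finite ballI eventually_conj)
    fix r s
    assume "r \<in> D'" "s \<in> D'"
    then show "\<forall>\<^sub>F m in sequentially. r \<noteq> s \<longrightarrow> f r m \<noteq> f s m"
      using diff[of r s] D' by (cases "r = s") (auto elim: eventually_mono)
  qed (use D' bound in auto)
  then obtain m where m: "\<forall>r\<in>D'. f r m < K \<and> (\<forall>s\<in>D'. r \<noteq> s \<longrightarrow> f r m \<noteq> f s m)"
    by (rule exE[OF eventually_happens'[OF sequentially_bot]])
  then have "inj_on (\<lambda>r. f r m) D'" "(\<lambda>r. f r m) ` D' \<subseteq> {..<K}"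
    by (auto simp: inj_on_def)
  then have "card D' \<le> card {..<K}"
    by (intro card_inj_on_le) auto
  then show False
    using D' by simp
qed


lemma common_tail_trans: "common_tail r s \<Longrightarrow> common_tail s t \<Longrightarrow> common_tail r t"
proof -
  assume "common_tail r s" "common_tail s t"
  then obtain m n m' n' where "\<forall>i. r (m + i) = s (n + i)" "\<forall>i. s (m' + i) = t (n' + i)"
    unfolding common_tail_def by blast
  then have "r (m + (m' + i)) = t (n' + (n + i))" for i
    by (metis add.left_commute)
  then have "r ((m + m') + i) = t ((n' + n) + i)" for i
    by (simp only: add.assoc)
  then show ?thesis
    unfolding common_tail_def by blast
qed

lemma common_tail_sym: "common_tail r s \<Longrightarrow> common_tail s r"
  unfolding common_tail_def by metis

lemma common_tail_refl: "common_tail r r"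
  unfolding common_tail_def by blast

lemma equiv_common_tail:
  "equiv {r. geodesic_ray G r} {(r, s). geodesic_ray G r \<and> geodesic_ray G s \<and> common_tail r s}"
proof (rule equivI)
  show "trans {(r, s). geodesic_ray G r \<and> geodesic_ray G s \<and> common_tail r s}"
    unfolding trans_def using common_tail_trans by blast
qed (auto simp: refl_on_def sym_def common_tail_refl intro: common_tail_sym)

lemma geodesic_ray_inj:
  assumes "geodesic_ray G r"
  shows "inj r"
proof (rule linorder_injI)
  fix i j :: nat
  assume "i < j"
  then have "undirected_distance G (r i) (r j) = j - i"
    using assms by (simp add: geodesic_ray_def)
  moreover have "undirected_distance G v v = 0" for v
    unfolding undirected_distance_def by (rule Least_equality) auto
  ultimately show "r i \<noteq> r j"
    using \<open>i < j\<close> by (metis less_irrefl zero_less_diff)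
qed

text \<open>For a sequence with pre-period \<open>k\<close> and period \<open>p\<close> this is the residue class of an index; for the
  kneading sequence, it numbers the generators.\<close>

definition level_colour :: "nat \<Rightarrow> nat \<Rightarrow> nat \<Rightarrow> nat" where
  "level_colour k p a = (if a < k then a else k + (a - k) mod p)"

lemma level_colour_less: "0 < p \<Longrightarrow> level_colour k p a < k + p"
  by (simp add: level_colour_def)

text \<open>If \<open>a < b\<close> have the same colour, then \<open>b = a + ep\<close> with \<open>e \<ge> 1\<close> and \<open>a \<ge> k\<close>. At position
  \<open>a - k\<close> the word then carries both \<open>c (k - 1)\<close>, the last letter of the pre-period, and
  \<open>c (k - 1 + ep)\<close>, the last letter of the period.\<close>

lemma same_colour_reads_unique:
  assumes k: "1 \<le> k" and p: "1 \<le> p"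
    and per: "\<And>n. k \<le> n \<Longrightarrow> c (n + p) = c n" and neq: "c (k - 1) \<noteq> c (k + p - 1)"
    and a: "reads c a v" and b: "reads c b v" and col: "level_colour k p a = level_colour k p b"
  shows "a = b"
proof -
  have less: False if "a < b" "reads c a v" "reads c b v" "level_colour k p a = level_colour k p b" for a b
  proof -
    have "k \<le> a"
      using that by (auto simp: level_colour_def split: if_splits)
    then have "(b - k) mod p = (a - k) mod p"
      using that by (auto simp: level_colour_def)
    then obtain e where e: "b - k = (a - k) + p * e"
      using \<open>a < b\<close> by (elim mod_eq_nat1E) auto
    have "e \<noteq> 0"
      using e \<open>k \<le> a\<close> \<open>a < b\<close> by (intro notI) simp
    then obtain e' where e': "e = Suc e'"
      using not0_implies_Suc by blast
    have shift: "c (k + p - 1 + p * l) = c (k + p - 1)" for l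
    proof (induction l)
      case (Suc l)
      have "k \<le> k + p - 1 + p * l"
        using p by simp
      then have "c (k + p - 1 + p * l + p) = c (k + p - 1 + p * l)"
        by (rule per)
      moreover have "k + p - 1 + p * l + p = k + p - 1 + p * Suc l"
        by simp
      ultimately show ?case
        using Suc by metis
    qed simp
    have "a - k < a" "a - k < b"
      using k \<open>k \<le> a\<close> \<open>a < b\<close> by simp_all
    then have "v (a - k) = c (a - 1 - (a - k))" "v (a - k) = c (b - 1 - (a - k))"
      using that(2,3) unfolding reads_def by blast+
    moreover have "a - 1 - (a - k) = k - 1"
      using k \<open>k \<le> a\<close> by simp
    moreover have "b - 1 - (a - k) = k + p - 1 + p * e'"
    proof -
      have "p * e = p + p * e'"
        using e' by simp
      then show ?thesis
        using e k p \<open>k \<le> a\<close> \<open>a < b\<close> by linarith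
    qed
    ultimately show False
      using neq shift by simp
  qed
  show ?thesis
    using less[of a b] less[of b a] a b col by (metis nat_neq_iff)
qed

text \<open>The word shifted by \<open>m\<close> reads \<open>n - m\<close>, so the colour determines \<open>n\<close>; then letters below
  \<open>n\<close> come from \<open>c\<close> and the others from \<open>u\<close>.\<close>

lemma exit_unique:
  assumes "1 \<le> k" and "1 \<le> p"
    and "\<And>n. k \<le> n \<Longrightarrow> c (n + p) = c n" and "c (k - 1) \<noteq> c (k + p - 1)"
    and v: "m \<le> n" "reads c n v" "agree_from m u v"
    and w: "m \<le> n'" "reads c n' w" "agree_from m u w"
    and col: "level_colour k p (n - m) = level_colour k p (n' - m)"
  shows "v = w"
proof -
  have shifted: "reads c (n - m) (\<lambda>i. u (i + m))" if "reads c n v" "agree_from m u v" for n v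
    unfolding reads_def
  proof (intro allI impI)
    fix i
    assume "i < n - m"
    then have "v (i + m) = c (n - 1 - (i + m))"
      using that(1) by (simp add: reads_def)
    moreover have "n - 1 - (i + m) = n - m - 1 - i"
      by simp
    ultimately show "u (i + m) = c (n - m - 1 - i)"
      using that(2) by (simp add: agree_from_def)
  qed
  have "n - m = n' - m"
    using same_colour_reads_unique[OF assms(1-4) shifted shifted] v w col by blast
  then have "n = n'"
    using v w by simp
  show ?thesis
  proof
    fix i
    show "v i = w i"
      using v w \<open>n = n'\<close> by (cases "i < n") (auto simp: reads_def agree_from_def)
  qed
qed

text \<open>Only adjacency matters for ends, so the arcs of \<open>T\<close> are left unspecified.\<close>

locale cofinal_tree =
  fixes c :: "nat \<Rightarrow> int" and T :: "(inf_word, 'b) pre_digraph" and u :: inf_word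
  assumes parcs_T: "parcs (mk_symmetric T) = {(v, w). cofinal_words u v \<and> cofinal_words u w \<and> level_adj c v w}"
begin

abbreviation end_relation :: "((nat \<Rightarrow> inf_word) \<times> (nat \<Rightarrow> inf_word)) set" where
  "end_relation \<equiv> {(r, s). geodesic_ray T r \<and> geodesic_ray T s \<and> common_tail r s}"

lemma end_class_eq_iff:
  assumes "geodesic_ray T r" and "geodesic_ray T s"
  shows "end_relation `` {r} = end_relation `` {s} \<longleftrightarrow> common_tail r s"
  using eq_equiv_class_iff[OF equiv_common_tail[of T], of r s] assms by simp

lemma geodesic_ray_adj:
  assumes "geodesic_ray T r"
  shows "level_adj c (r i) (r (Suc i))" and "cofinal_words u (r i)"
  using assms parcs_T by (auto simp: geodesic_ray_def)

lemma geodesic_ray_reduced: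
  assumes "geodesic_ray T r"
  shows "reduced_walk (level_adj c) r n"
  unfolding reduced_walk_def using geodesic_ray_adj[OF assms] geodesic_ray_inj[OF assms]
  by (simp add: inj_eq)

lemma geodesic_ray_levels:
  assumes "geodesic_ray T r"
  obtains lev where "\<And>i. level_edge c (lev i) (r i) (r (Suc i))"
proof -
  have "\<forall>i. \<exists>n. level_edge c n (r i) (r (Suc i))"
    using geodesic_ray_adj(1)[OF assms] by (simp add: level_adj_def)
  from choice[OF this] show ?thesis
    using that by blast
qed

text \<open>Each such end is determined by a vertex, a level and a direction of the line that contains its
  tail.\<close>

lemma countable_bounded_ends:
  "countable ((\<lambda>r. end_relation `` {r}) `
     {r. geodesic_ray T r \<and> (\<exists>L. \<forall>i n. level_edge c n (r i) (r (Suc i)) \<longrightarrow> n \<le> L)})"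
    (is "countable (?cls ` ?R)")
proof (rule countable_subset)
  define line where "line = (\<lambda>(v :: inf_word, M :: nat, d :: int). \<lambda>l. v(M := v M + d * int l))"
  show "?cls ` ?R \<subseteq>
      (\<lambda>x. {s. geodesic_ray T s \<and> common_tail (line x) s}) ` ({v. cofinal_words u v} \<times> UNIV \<times> UNIV)"
  proof (rule image_subsetI)
    fix r
    assume "r \<in> ?R"
    then obtain L where r: "geodesic_ray T r" and L: "\<And>i n. level_edge c n (r i) (r (Suc i)) \<Longrightarrow> n \<le> L"
      by blast
    obtain lev where lev: "\<And>i. level_edge c (lev i) (r i) (r (Suc i))"
      using geodesic_ray_levels[OF r] by blast
    obtain i0 M d where "\<forall>l. r (i0 + l) = (r i0)(M := r i0 M + d * int l)"
      using bounded_ray_straight[OF geodesic_ray_inj[OF r] lev L[OF lev]] by blast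
    then have "\<forall>l. r (i0 + l) = line (r i0, M, d) (0 + l)"
      by (simp add: line_def)
    then have tail: "common_tail r (line (r i0, M, d))"
      unfolding common_tail_def by blast
    have "?cls r = {s. geodesic_ray T s \<and> common_tail (line (r i0, M, d)) s}"
      using r common_tail_trans[OF tail] common_tail_trans[OF common_tail_sym[OF tail]] by blast
    moreover have "(r i0, M, d) \<in> {v. cofinal_words u v} \<times> UNIV \<times> UNIV"
      using geodesic_ray_adj[OF r] by simp
    ultimately show "?cls r \<in> (\<lambda>x. {s. geodesic_ray T s \<and> common_tail (line x) s}) `
        ({v. cofinal_words u v} \<times> UNIV \<times> UNIV)"
      by blast
  qed
  show "countable ((\<lambda>x. {s. geodesic_ray T s \<and> common_tail (line x) s}) `
      ({v. cofinal_words u v} \<times> UNIV \<times> UNIV))"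
    by (intro countable_image countable_SIGMA countable_cofinal) simp_all
qed

text \<open>Give a ray, for each \<open>m\<close>, the colour of an exit from the block of words that agree with \<open>u\<close>
  from \<open>m\<close> on. Rays with the same colour at \<open>m\<close> share the exit vertex, which is far out on
  both rays when \<open>m\<close> is large. Inequivalent rays therefore have eventually different colours.\<close>

lemma finite_unbounded_ends:
  assumes k: "1 \<le> k" and p: "1 \<le> p"
    and per: "\<And>n. k \<le> n \<Longrightarrow> c (n + p) = c n" and neq: "c (k - 1) \<noteq> c (k + p - 1)"
  shows "finite ((\<lambda>r. end_relation `` {r}) `
     {r. geodesic_ray T r \<and> (\<nexists>L. \<forall>i n. level_edge c n (r i) (r (Suc i)) \<longrightarrow> n \<le> L)})"
    (is "finite (?cls ` ?R)")
proof -
  \<comment> \<open>One representative for each end.\<close>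
  obtain D where D: "D \<subseteq> ?R" "inj_on ?cls D" "?cls ` ?R = ?cls ` D"
    using subset_image_inj[of "?cls ` ?R" ?cls ?R] by auto
  define exit where "exit r m col \<longleftrightarrow> (\<exists>i n. m \<le> n \<and> level_edge c n (r i) (r (Suc i)) \<and>
      agree_from m u (r i) \<and> col = level_colour k p (n - m))" for r :: "nat \<Rightarrow> inf_word" and m col
  define f where "f r m = (SOME col. exit r m col)" for r m
  have exit_f: "\<forall>\<^sub>F m in sequentially. exit r m (f r m)" if "r \<in> D" for r
  proof -
    have r: "geodesic_ray T r" "\<nexists>L. \<forall>i n. level_edge c n (r i) (r (Suc i)) \<longrightarrow> n \<le> L"
      using that D by auto
    obtain lev where lev: "\<And>i. level_edge c (lev i) (r i) (r (Suc i))"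
      using geodesic_ray_levels[OF r(1)] by blast
    have unbounded: "\<exists>i. L < lev i" for L
    proof (rule ccontr)
      assume "\<nexists>i. L < lev i"
      then have "n \<le> L" if "level_edge c n (r i) (r (Suc i))" for i n
        using level_edge_unique[OF lev that] by (simp add: not_less)
      then show False
        using r(2) by blast
    qed
    obtain m0 where "agree_from m0 u (r 0)"
      using geodesic_ray_adj(2)[OF r(1)] unfolding cofinal_words_def by blast
    have ex: "\<exists>col. exit r m col" if "m0 \<le> m" for m
    proof -
      have "\<exists>i n. m \<le> n \<and> level_edge c n (r i) (r (Suc i)) \<and> agree_from m u (r i)"
        using lev unbounded agree_from_mono[OF \<open>agree_from m0 u (r 0)\<close> that]
        by (rule unbounded_ray_exits)
      then show ?thesis
        unfolding exit_def by blast
    qed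
    have "exit r m (f r m)" if "m0 \<le> m" for m
      unfolding f_def by (rule someI_ex[OF ex[OF that]])
    then show ?thesis
      unfolding eventually_sequentially by blast
  qed
  have "finite D"
  proof (rule finite_eventually_different)
    fix r
    assume "r \<in> D"
    show "\<forall>\<^sub>F m in sequentially. f r m < k + p"
      using exit_f[OF \<open>r \<in> D\<close>] by (rule eventually_mono) (use p level_colour_less in \<open>auto simp: exit_def\<close>)
  next
    fix r s
    assume rs: "r \<in> D" "s \<in> D" "r \<noteq> s"
    then have rays: "geodesic_ray T r" "geodesic_ray T s"
      using D by auto
    have "\<not> common_tail r s"
      using inj_onD[OF D(2) _ rs(1,2)] rs(3) end_class_eq_iff[OF rays] by blast
    moreover have "common_tail r s" if "\<And>N. \<exists>i\<ge>N. \<exists>j\<ge>N. r i = s j"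
      using level_walk_unique geodesic_ray_reduced[OF rays(1)] geodesic_ray_reduced[OF rays(2)] that
      by (rule rays_meeting_infinitely_often_common_tail)
    ultimately obtain N where N: "\<And>i j. N \<le> i \<Longrightarrow> N \<le> j \<Longrightarrow> r i \<noteq> s j"
      by blast
    obtain lev lev' where lev: "\<And>i. level_edge c (lev i) (r i) (r (Suc i))"
        "\<And>i. level_edge c (lev' i) (s i) (s (Suc i))"
      using geodesic_ray_levels rays by metis
    \<comment> \<open>For \<open>m\<close> this large, an exit of level at least \<open>m\<close> happens no earlier than time \<open>N\<close>.\<close>
    have late: "\<forall>\<^sub>F m in sequentially. \<forall>i\<in>{..<N}. lev i < m \<and> lev' i < m"
      by (intro eventually_ball_finite ballI eventually_conj eventually_gt_at_top) simp
    show "\<forall>\<^sub>F m in sequentially. f r m \<noteq> f s m"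
      using exit_f[OF rs(1)] exit_f[OF rs(2)] late
    proof eventually_elim
      case (elim m)
      obtain i n where i: "m \<le> n" "level_edge c n (r i) (r (Suc i))" "agree_from m u (r i)"
          "f r m = level_colour k p (n - m)"
        using elim(1) unfolding exit_def by blast
      obtain j n' where j: "m \<le> n'" "level_edge c n' (s j) (s (Suc j))" "agree_from m u (s j)"
          "f s m = level_colour k p (n' - m)"
        using elim(2) unfolding exit_def by blast
      have "lev i = n" "lev' j = n'"
        by (rule level_edge_unique[OF i(2) lev(1)], rule level_edge_unique[OF j(2) lev(2)])
      then have "N \<le> i" "N \<le> j"
        using elim(3) i(1) j(1) by (auto simp flip: not_less)
      then have "r i \<noteq> s j"
        by (rule N)
      moreover have "r i = s j" if "level_colour k p (n - m) = level_colour k p (n' - m)"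
        using k p per neq i(1) level_edge_readsD(1)[OF i(2)] i(3) j(1) level_edge_readsD(1)[OF j(2)]
          j(3) that by (rule exit_unique)
      ultimately show ?case
        using i(4) j(4) by auto
    qed
  qed
  then show ?thesis
    using D(3) by simp
qed

lemma countable_ends:
  assumes "1 \<le> k" and "1 \<le> p"
    and "\<And>n. k \<le> n \<Longrightarrow> c (n + p) = c n" and "c (k - 1) \<noteq> c (k + p - 1)"
  shows "countable (tree_ends T)"
proof -
  let ?bounded = "\<lambda>r. \<exists>L. \<forall>i n. level_edge c n (r i) (r (Suc i)) \<longrightarrow> n \<le> L"
  have "tree_ends T = (\<lambda>r. end_relation `` {r}) ` {r. geodesic_ray T r}"
    unfolding tree_ends_def quotient_def by (rule UNION_singleton_eq_range)
  also have "{r. geodesic_ray T r} =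
      {r. geodesic_ray T r \<and> ?bounded r} \<union> {r. geodesic_ray T r \<and> \<not> ?bounded r}"
    by blast
  finally have "tree_ends T = (\<lambda>r. end_relation `` {r}) ` {r. geodesic_ray T r \<and> ?bounded r} \<union>
      (\<lambda>r. end_relation `` {r}) ` {r. geodesic_ray T r \<and> \<not> ?bounded r}"
    by (simp only: image_Un)
  then show ?thesis
    using countable_bounded_ends countable_finite[OF finite_unbounded_ends[OF assms]] by simp
qed

lemma distance_ge_first_letter:
  "(v, w) \<in> parcs (mk_symmetric T) ^^ n \<Longrightarrow> \<bar>w 0 - v 0\<bar> \<le> int n"
proof (induction n arbitrary: w)
  case (Suc n)
  then obtain x where x: "\<bar>x 0 - v 0\<bar> \<le> int n" "(x, w) \<in> parcs (mk_symmetric T)"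
    by auto
  then obtain m where m: "level_edge c m x w"
    by (auto simp: parcs_T level_adj_def)
  have "\<bar>w 0 - x 0\<bar> \<le> 1"
    using level_edge_at[OF m] level_edge_other[OF m, of 0] by (cases "m = 0") auto
  then show ?case
    using x by simp
qed simp

text \<open>Level 0 has no prefix condition, so the first letter can be moved freely; by the previous bound
  no walk moves it faster.\<close>

lemma first_letter_ray_geodesic:
  assumes "cofinal_words u v"
  shows "geodesic_ray T (\<lambda>i. v(0 := int i))"
proof -
  let ?r = "\<lambda>i. v(0 := int i)"
  have cof: "cofinal_words u (?r i)" for i
  proof -
    have "agree_from 1 v (?r i)"
      by (simp add: agree_from_def)
    then show ?thesis
      using assms cofinal_trans cofinal_words_def by blast
  qed
  have "level_edge c 0 (?r i) (?r (Suc i))" for i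
    unfolding level_edge_def by (auto simp: reads_def intro!: exI[of _ 1])
  then have step: "(?r i, ?r (Suc i)) \<in> parcs (mk_symmetric T)" for i
    using cof[of i] cof[of "Suc i"] unfolding parcs_T level_adj_def by blast
  have path: "(?r i, ?r (i + n)) \<in> parcs (mk_symmetric T) ^^ n" for i n
  proof (induction n)
    case (Suc n)
    then show ?case
      using relpow_Suc_I[OF Suc step[of "i + n"]] by (simp only: add_Suc_right)
  qed simp
  have "undirected_distance T (?r i) (?r j) = j - i" if "i \<le> j" for i j
    unfolding undirected_distance_def
  proof (rule Least_equality)
    show "(?r i, ?r j) \<in> parcs (mk_symmetric T) ^^ (j - i)"
      using path[of i "j - i"] that by simp
    show "j - i \<le> n" if "(?r i, ?r j) \<in> parcs (mk_symmetric T) ^^ n" for n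
      using distance_ge_first_letter[OF that] by simp
  qed
  then show ?thesis
    using step by (simp add: geodesic_ray_def)
qed

text \<open>The second letter, constant on each of these lines, tells their ends apart.\<close>

lemma infinite_ends: "infinite (tree_ends T)"
proof -
  let ?r = "\<lambda>z i. (u(1 := z))(0 := int i)"
  have "cofinal_words u (u(1 := z))" for z
    unfolding cofinal_words_def agree_from_def by (intro exI[of _ 2]) simp
  then have ray: "geodesic_ray T (?r z)" for z
    by (rule first_letter_ray_geodesic)
  have "inj (\<lambda>z. end_relation `` {?r z})"
  proof (rule injI)
    fix z z' :: int
    assume "end_relation `` {?r z} = end_relation `` {?r z'}"
    then have "common_tail (?r z) (?r z')"
      using end_class_eq_iff[OF ray ray] by blast
    then obtain m n where "?r z (m + 0) = ?r z' (n + 0)"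
      unfolding common_tail_def by blast
    then have "?r z (m + 0) 1 = ?r z' (n + 0) 1"
      by (rule arg_cong)
    then show "z = z'"
      by simp
  qed
  then have "infinite (range (\<lambda>z. end_relation `` {?r z}))"
    by (simp add: finite_image_iff)
  moreover have "range (\<lambda>z. end_relation `` {?r z}) \<subseteq> tree_ends T"
    unfolding tree_ends_def using ray by (intro image_subsetI quotientI) blast
  ultimately show ?thesis
    using finite_subset by blast
qed

end


section \<open>The kneading automaton\<close>

definition kneading_sequence :: "int list \<Rightarrow> int list \<Rightarrow> nat \<Rightarrow> int" where
  "kneading_sequence xs ys n =
     (if n < length xs then letter xs (Suc n)
      else letter ys (Suc ((n - length xs) mod length ys)))"

text \<open>The generator that acts at level \<open>n\<close>. From \<open>level_state (n + 1)\<close> the letter \<open>c n\<close> leads to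
  \<open>level_state n\<close>, and \<open>level_state 0 = a\<^sub>1\<close>.\<close>

definition level_state :: "int list \<Rightarrow> int list \<Rightarrow> nat \<Rightarrow> state" where
  "level_state xs ys n =
     (if n < length xs then A (Suc n) else B (Suc ((n - length xs) mod length ys)))"

definition generator_states :: "int list \<Rightarrow> int list \<Rightarrow> state set" where
  "generator_states xs ys = {A i | i. 1 \<le> i \<and> i \<le> length xs} \<union> {B j | j. 1 \<le> j \<and> j \<le> length ys}"

lemma kneading_generators_eq:
  "kneading_generators xs ys = state_action xs ys ` generator_states xs ys"
  unfolding kneading_generators_def generator_states_def by blast

lemma state_action_Id: "state_action xs ys Id_State v = v"
  by (induction v) auto

lemma kneading_sequence_periodic:
  assumes "length xs \<le> n"
  shows "kneading_sequence xs ys (n + length ys) = kneading_sequence xs ys n"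
proof -
  have "n + length ys - length xs = n - length xs + length ys"
    using assms by simp
  then have "(n + length ys - length xs) mod length ys = (n - length xs) mod length ys"
    by (simp only: mod_add_self2)
  then show ?thesis
    using assms by (simp add: kneading_sequence_def)
qed

context
  fixes xs ys :: "int list"
  assumes k: "length xs \<ge> 1" and p: "length ys \<ge> 1"
    and last_letters: "letter xs (length xs) \<noteq> letter ys (length ys)"
begin

private abbreviation "c \<equiv> kneading_sequence xs ys"

lemma level_state_generator: "level_state xs ys n \<in> generator_states xs ys"
  using p by (auto simp: level_state_def generator_states_def Suc_le_eq)

text \<open>At the wrap-around, where \<open>b\<^sub>1\<close> must pass to \<open>b\<^sub>p\<close> on the letter \<open>y\<^sub>p\<close>, the transition
  to \<open>a\<^sub>k\<close> is excluded by \<open>x\<^sub>k \<noteq> y\<^sub>p\<close>.\<close>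

lemma transition_level_state:
  "kneading_transition xs ys (level_state xs ys (Suc n)) (c n) = (c n, level_state xs ys n)"
proof -
  consider "Suc n < length xs" | "Suc n = length xs" | "length xs \<le> n"
    by linarith
  then show ?thesis
  proof cases
    case 3
    have "Suc n - length xs = Suc (n - length xs)"
      using 3 by simp
    then show ?thesis
      using 3 last_letters by (auto simp: level_state_def kneading_sequence_def mod_Suc)
  qed (auto simp: level_state_def kneading_sequence_def)
qed

lemma transition_to_level_state:
  assumes "q \<in> generator_states xs ys" and "q \<noteq> A 1"
    and "kneading_transition xs ys q z = (z', q')"
  shows "z' = z" and "q' = Id_State \<or> q' \<in> generator_states xs ys"
    and "q' = level_state xs ys n \<Longrightarrow> z = c n \<and> q = level_state xs ys (Suc n)"
proof -
  show "z' = z"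
    using assms by (cases q) (auto split: if_splits)
  show "q' = Id_State \<or> q' \<in> generator_states xs ys"
    using assms k p by (cases q) (auto simp: generator_states_def split: if_splits)
  assume q': "q' = level_state xs ys n"
  show "z = c n \<and> q = level_state xs ys (Suc n)"
  proof (cases q)
    case Id_State
    then show ?thesis
      using assms(1) by (simp add: generator_states_def)
  next
    case (A i)
    then obtain l where "i = Suc (Suc l)"
      using assms(1,2) by (cases i rule: nat.exhaust; cases "i - 1") (auto simp: generator_states_def)
    then show ?thesis
      using A assms q' by (auto simp: level_state_def kneading_sequence_def generator_states_def
          split: if_splits)
  next
    case (B j)
    then obtain l where l: "j = Suc l"
      using assms(1) by (cases j) (auto simp: generator_states_def)
    show ?thesis
    proof (cases "n < length xs")
      case True
      then show ?thesis
        using B l assms q' by (auto simp: level_state_def kneading_sequence_def generator_states_def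
          split: if_splits)
    next
      case False
      then have "Suc n - length xs = Suc (n - length xs)"
        by simp
      then show ?thesis
        using False B l assms q' by (auto simp: level_state_def kneading_sequence_def
          generator_states_def mod_Suc split: if_splits)
    qed
  qed
qed

text \<open>The word may be shorter than \<open>n + 1\<close>: the list update is then void, as is the action.\<close>

lemma level_state_action:
  assumes "\<And>i. i < n \<Longrightarrow> i < length v \<Longrightarrow> v ! i = c (n - 1 - i)"
  shows "state_action xs ys (level_state xs ys n) v = v[n := v ! n + 1]"
  using assms
proof (induction n arbitrary: v)
  case 0
  then show ?case
    using k by (cases v) (auto simp: level_state_def state_action_Id)
next
  case (Suc n)
  show ?case
  proof (cases v)
    case (Cons z w)
    then have "z = c n"
      using Suc.prems[of 0] by simp
    moreover have "w ! i = c (n - 1 - i)" if "i < n" "i < length w" for i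
      using Suc.prems[of "Suc i"] that Cons by simp
    ultimately show ?thesis
      using Suc.IH[of w] Cons by (simp add: transition_level_state)
  qed simp
qed

text \<open>A word is moved only if the automaton does not reach the identity state before it has reached
  \<open>a\<^sub>1\<close>, and the transitions allow only one way to do so.\<close>

lemma state_action_moves:
  assumes "q \<in> generator_states xs ys" and "state_action xs ys q v \<noteq> v"
  shows "\<exists>n<length v. q = level_state xs ys n \<and> (\<forall>i<n. v ! i = c (n - 1 - i))"
  using assms
proof (induction v arbitrary: q)
  case (Cons z w)
  show ?case
  proof (cases "q = A 1")
    case True
    moreover have "0 < length xs"
      using k by linarith
    ultimately have "q = level_state xs ys 0"
      by (simp add: level_state_def)
    then show ?thesis
      by (intro exI[of _ 0]) simp
  next
    case False
    obtain z' q' where tr: "kneading_transition xs ys q z = (z', q')"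
      by fastforce
    note tr_props = transition_to_level_state[OF Cons.prems(1) False tr]
    have moves: "state_action xs ys q' w \<noteq> w"
      using Cons.prems(2) tr tr_props(1) by auto
    then have "q' \<in> generator_states xs ys"
      using tr_props(2) state_action_Id by auto
    then obtain n where n: "n < length w" "q' = level_state xs ys n" "\<forall>i<n. w ! i = c (n - 1 - i)"
      using Cons.IH moves by blast
    have "(z # w) ! i = c (Suc n - 1 - i)" if "i < Suc n" for i
      using n tr_props(3)[OF n(2)] that by (cases i) auto
    then show ?thesis
      using n tr_props(3)[OF n(2)] by (intro exI[of _ "Suc n"]) auto
  qed
qed simp

lemma boundary_action_level_state:
  assumes "reads c n v"
  shows "boundary_action (state_action xs ys (level_state xs ys n)) v = v(n := v n + 1)"
proof
  fix j
  have "state_action xs ys (level_state xs ys n) (map v [0..<Suc j]) =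
      (map v [0..<Suc j])[n := map v [0..<Suc j] ! n + 1]"
    using assms by (intro level_state_action) (simp add: reads_def del: upt_Suc)
  then show "boundary_action (state_action xs ys (level_state xs ys n)) v j = (v(n := v n + 1)) j"
    by (simp add: boundary_action_def nth_list_update del: upt_Suc)
qed

lemma boundary_action_moves:
  assumes "q \<in> generator_states xs ys" and "boundary_action (state_action xs ys q) v \<noteq> v"
  obtains n where "q = level_state xs ys n" and "reads c n v"
proof -
  obtain j where "boundary_action (state_action xs ys q) v j \<noteq> v j"
    using assms(2) by blast
  then have "state_action xs ys q (map v [0..<Suc j]) ! j \<noteq> map v [0..<Suc j] ! j"
    by (simp add: boundary_action_def del: upt_Suc)
  then have "state_action xs ys q (map v [0..<Suc j]) \<noteq> map v [0..<Suc j]"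
    by metis
  then obtain n where n: "n < length (map v [0..<Suc j])" "q = level_state xs ys n"
      "\<forall>i<n. map v [0..<Suc j] ! i = c (n - 1 - i)"
    using state_action_moves[OF assms(1)] by blast
  then have "reads c n v"
    by (simp add: reads_def del: upt_Suc)
  then show ?thesis
    using that n by blast
qed


section \<open>The Schreier graph\<close>

private abbreviation (input) "G \<equiv> kneading_schreier_graph xs ys"

private abbreviation level_generator :: "nat \<Rightarrow> int list \<Rightarrow> int list" where
  "level_generator n \<equiv> state_action xs ys (level_state xs ys n)"

lemma verts_G: "verts G = UNIV"
  and tail_G: "tail G = fst"
  and head_G: "head G = (\<lambda>(v, s). boundary_action s v)"
  by (simp_all add: kneading_schreier_graph_def delete_loops_def orbital_schreier_graph_def)

lemma arcs_G: "arcs G = {(v, level_generator n) | v n. reads c n v}" (is "_ = ?R")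
proof (intro equalityI subsetI)
  fix e
  assume "e \<in> arcs G"
  then obtain v q where e: "e = (v, state_action xs ys q)" "q \<in> generator_states xs ys"
      "boundary_action (state_action xs ys q) v \<noteq> v"
    by (auto simp: kneading_schreier_graph_def delete_loops_def orbital_schreier_graph_def
        kneading_generators_eq)
  then show "e \<in> ?R"
    using boundary_action_moves[OF e(2,3)] by blast
next
  fix e
  assume "e \<in> ?R"
  then obtain v n where e: "e = (v, level_generator n)" "reads c n v"
    by blast
  have "boundary_action (level_generator n) v \<noteq> v"
    unfolding boundary_action_level_state[OF e(2)] by (metis fun_upd_same add_cancel_left_right zero_neq_one)
  then show "e \<in> arcs G"
    using e(1) level_state_generator[of n]
    by (auto simp: kneading_schreier_graph_def delete_loops_def orbital_schreier_graph_def
        kneading_generators_eq)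
qed

lemma arc_G_cases:
  assumes "e \<in> arcs G"
  obtains v n where "e = (v, level_generator n)" "reads c n v" "tail G e = v"
    "head G e = v(n := v n + 1)"
  using assms unfolding arcs_G tail_G head_G using boundary_action_level_state by fastforce

lemma arc_G_adj:
  assumes "e \<in> arcs G"
  shows "level_adj c (tail G e) (head G e)"
proof -
  obtain v n where "reads c n v" "tail G e = v" "head G e = v(n := v n + 1)"
    using arc_G_cases[OF assms] by metis
  then have "level_edge c n (tail G e) (head G e)"
    unfolding level_edge_def by (intro conjI exI[of _ 1]) simp_all
  then show ?thesis
    by (auto simp: level_adj_def)
qed

lemma level_adj_arc:
  assumes "level_adj c v w"
  obtains e where "e \<in> arcs G" and "(tail G e, head G e) \<in> {(v, w), (w, v)}"
proof -
  obtain n d where d: "reads c n v" "\<bar>d\<bar> = 1" "w = v(n := v n + d)"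
    using assms by (auto simp: level_adj_def level_edge_def)
  have arc: "(x, level_generator n) \<in> arcs G" "tail G (x, level_generator n) = x"
      "head G (x, level_generator n) = x(n := x n + 1)" if "reads c n x" for x
    using boundary_action_level_state[OF that] that by (auto simp: arcs_G tail_G head_G)
  show ?thesis
  proof (cases "d = 1")
    case True
    then show ?thesis
      using that arc[OF d(1)] d(3) by (metis insertI1)
  next
    case False
    then have "d = -1"
      using d(2) by auto
    then have "reads c n w" "w(n := w n + 1) = v"
      using d by (simp_all add: reads_upd)
    then show ?thesis
      using that arc[of w] by (metis insertI1 insertI2)
  qed
qed

text \<open>Parallel arcs would change the same letter at the same prefix, so carry the same generator;
  opposite arcs are excluded since every arc increases a letter.\<close>

lemma arc_G_unique:
  assumes "e \<in> arcs G" and "e' \<in> arcs G"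
    and "{tail G e, head G e} = {tail G e', head G e'}"
  shows "e = e'"
proof -
  obtain v n where e: "e = (v, level_generator n)" "tail G e = v" "head G e = v(n := v n + 1)"
    using arc_G_cases[OF assms(1)] by metis
  obtain v' n' where e': "e' = (v', level_generator n')" "tail G e' = v'"
      "head G e' = v'(n' := v' n' + 1)"
    using arc_G_cases[OF assms(2)] by metis
  consider "v = v'" "v(n := v n + 1) = v'(n' := v' n' + 1)"
    | "v = v'(n' := v' n' + 1)" "v' = v(n := v n + 1)"
    using assms(3) unfolding e(2,3) e'(2,3) doubleton_eq_iff by metis
  then show ?thesis
  proof cases
    case 1
    have "n = n'"
      using fun_cong[OF 1(2), of n] 1(1) by (cases "n = n'") simp_all
    then show ?thesis
      using 1 e e' by simp
  next
    case 2
    have "v n = (if n = n' then v' n + 1 else v' n)" "v' n = v n + 1"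
      using fun_cong[OF 2(1), of n] fun_cong[OF 2(2), of n] by (simp_all split: if_splits)
    then show ?thesis
      by (simp split: if_splits)
  qed
qed

lemma parcs_G_induced:
  "parcs (mk_symmetric (G \<restriction> F)) = {(v, w). v \<in> F \<and> w \<in> F \<and> level_adj c v w}"
proof (intro equalityI subsetI)
  fix x
  assume "x \<in> parcs (mk_symmetric (G \<restriction> F))"
  then show "x \<in> {(v, w). v \<in> F \<and> w \<in> F \<and> level_adj c v w}"
    using arc_G_adj level_adj_sym by (auto simp: parcs_mk_symmetric)
next
  fix x
  assume "x \<in> {(v, w). v \<in> F \<and> w \<in> F \<and> level_adj c v w}"
  then obtain v w where x: "x = (v, w)" "v \<in> F" "w \<in> F" "level_adj c v w"
    by blast
  obtain e where e: "e \<in> arcs G" "(tail G e, head G e) \<in> {(v, w), (w, v)}"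
    using level_adj_arc[OF x(4)] by blast
  then have "e \<in> arcs (G \<restriction> F)"
    using x by auto
  moreover have "x \<in> {(tail G e, head G e), (head G e, tail G e)}"
    using e(2) x(1) by auto
  ultimately show "x \<in> parcs (mk_symmetric (G \<restriction> F))"
    unfolding parcs_mk_symmetric by (auto simp del: induce_subgraph_arcs)
qed

lemma reachable_G_induced:
  assumes closed: "\<And>v w. v \<in> F \<Longrightarrow> level_adj c v w \<Longrightarrow> w \<in> F" and "v \<in> F"
  shows "v \<rightarrow>\<^sup>*\<^bsub>with_proj (mk_symmetric (G \<restriction> F))\<^esub> w \<longleftrightarrow> (level_adj c)\<^sup>*\<^sup>* v w"
proof
  assume "v \<rightarrow>\<^sup>*\<^bsub>with_proj (mk_symmetric (G \<restriction> F))\<^esub> w"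
  then have "(v, w) \<in> rtrancl_on F {(v, w). v \<in> F \<and> w \<in> F \<and> level_adj c v w}"
    by (simp add: reachable_def parcs_G_induced)
  then show "(level_adj c)\<^sup>*\<^sup>* v w"
    by induction (auto intro: rtranclp.rtrancl_into_rtrancl)
next
  assume "(level_adj c)\<^sup>*\<^sup>* v w"
  then have "w \<in> F \<and> (v, w) \<in> rtrancl_on F {(v, w). v \<in> F \<and> w \<in> F \<and> level_adj c v w}"
    by induction (use closed \<open>v \<in> F\<close> in \<open>auto intro: rtrancl_on_into_rtrancl_on\<close>)
  then show "v \<rightarrow>\<^sup>*\<^bsub>with_proj (mk_symmetric (G \<restriction> F))\<^esub> w"
    by (simp add: reachable_def parcs_G_induced)
qed

lemma G_induced_UNIV: "G \<restriction> UNIV = G"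
  by (cases G) (use verts_G in \<open>simp add: induce_subgraph_def\<close>)

lemma level_adj_rtrancl_iff: "(level_adj c)\<^sup>*\<^sup>* u v \<longleftrightarrow> cofinal_words u v"
proof
  assume "(level_adj c)\<^sup>*\<^sup>* u v"
  then show "cofinal_words u v"
    by induction (auto intro: cofinal_refl cofinal_trans level_adj_cofinal)
qed (auto simp: cofinal_words_def intro: agree_from_connected)

lemma component_G: "component_of G u = G \<restriction> {v. cofinal_words u v}"
proof -
  have "u \<rightarrow>\<^sup>*\<^bsub>with_proj (mk_symmetric G)\<^esub> v \<longleftrightarrow> cofinal_words u v" for v
    using reachable_G_induced[of UNIV u v] unfolding G_induced_UNIV level_adj_rtrancl_iff by simp
  then show ?thesis
    by (simp only: component_of_def)
qed

lemma T_graph_eq: "T_graph xs ys u = G \<restriction> {v. cofinal_words u v}"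
proof -
  have level: "T_level xs ys m u = G \<restriction> {v. agree_from m u v}" for m
    by (simp add: T_level_def agree_from_def)
  have common: "(\<exists>m. agree_from m u v \<and> agree_from m u w) \<longleftrightarrow> cofinal_words u v \<and> cofinal_words u w"
    for v w
    using agree_from_mono unfolding cofinal_words_def by (metis nat_le_linear)
  have "(\<Union>m. arcs (G \<restriction> {v. agree_from m u v})) = arcs (G \<restriction> {v. cofinal_words u v})"
    using common by auto
  moreover have "(\<Union>m. verts (G \<restriction> {v. agree_from m u v})) = verts (G \<restriction> {v. cofinal_words u v})"
    by (auto simp: cofinal_words_def)
  ultimately show ?thesis
    unfolding T_graph_def pre_digraph.Union_def level
    by (simp add: induce_subgraph_def)
qed

lemma connected_component: "connected (G \<restriction> {v. cofinal_words u v})"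
  unfolding connected_def strongly_connected_def
proof (intro conjI ballI)
  fix v w
  assume "v \<in> verts (with_proj (mk_symmetric (G \<restriction> {v. cofinal_words u v})))"
    and "w \<in> verts (with_proj (mk_symmetric (G \<restriction> {v. cofinal_words u v})))"
  then have vw: "cofinal_words u v" "cofinal_words u w"
    by simp_all
  have "v \<rightarrow>\<^sup>*\<^bsub>with_proj (mk_symmetric (G \<restriction> {v. cofinal_words u v}))\<^esub> w \<longleftrightarrow> (level_adj c)\<^sup>*\<^sup>* v w"
    using vw by (intro reachable_G_induced) (auto intro: cofinal_trans level_adj_cofinal)
  then show "v \<rightarrow>\<^sup>*\<^bsub>with_proj (mk_symmetric (G \<restriction> {v. cofinal_words u v}))\<^esub> w"
    using vw cofinal_trans cofinal_sym level_adj_rtrancl_iff by blast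
qed (use cofinal_refl in auto)

text \<open>A cycle of length at least 3 is a closed reduced walk. Shorter ones would be loops or pairs of
  arcs with the same endpoints.\<close>

lemma no_undirected_cycle: "\<not> undirected_cycle (G \<restriction> F) vs es"
proof
  assume cycle: "undirected_cycle (G \<restriction> F) vs es"
  define n where "n = length es"
  have n: "n \<noteq> 0" "length vs = n" "distinct vs" "distinct es"
    and es: "set es \<subseteq> arcs (G \<restriction> F)"
    and ends: "\<And>i. i < n \<Longrightarrow> {tail G (es ! i), head G (es ! i)} = {vs ! i, vs ! (Suc i mod n)}"
    using cycle by (auto simp: undirected_cycle_def n_def)
  have arcs: "es ! i \<in> arcs G" if "i < n" for i
    using subsetD[OF es nth_mem] that by (simp add: n_def)
  have adj: "level_adj c (vs ! i) (vs ! (Suc i mod n))" if "i < n" for i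
    using arc_G_adj[OF arcs[OF that]] level_adj_sym ends[OF that] by (metis doubleton_eq_iff)
  have irrefl: "\<not> level_adj c v v" for v
    using level_edge_at by (fastforce simp: level_adj_def)
  consider "n = 1" | "n = 2" | "n \<ge> 3"
    using n(1) by linarith
  then show False
  proof cases
    case 1
    then show False
      using adj[of 0] irrefl by simp
  next
    case 2
    have "es ! 0 = es ! 1"
    proof (rule arc_G_unique)
      show "{tail G (es ! 0), head G (es ! 0)} = {tail G (es ! 1), head G (es ! 1)}"
        using ends[of 0] ends[of 1] 2 by auto
    qed (use arcs 2 in auto)
    then show False
      using n(4) 2 by (simp add: nth_eq_iff_index_eq n_def)
  next
    case 3
    have "reduced_walk (level_adj c) (\<lambda>i. vs ! (i mod n)) n"
      unfolding reduced_walk_def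
    proof (intro conjI allI impI)
      show "level_adj c (vs ! (i mod n)) (vs ! (Suc i mod n))" if "i < n" for i
        using adj[OF that] that by simp
      show "vs ! (i mod n) \<noteq> vs ! (Suc (Suc i) mod n)" if "Suc (Suc i) \<le> n" for i
      proof -
        have "i mod n \<noteq> Suc (Suc i) mod n"
          using that 3 by (cases "Suc (Suc i) = n") auto
        then show ?thesis
          using n by (simp add: nth_eq_iff_index_eq)
      qed
    qed
    then show False
      using no_closed_reduced_walk[of c "\<lambda>i. vs ! (i mod n)" n] 3 by simp
  qed
qed

lemma cofinal_tree_T: "cofinal_tree c (G \<restriction> {v. cofinal_words u v}) u"
  by unfold_locales (auto simp: parcs_G_induced)

lemma T_graph_ends:
  "countable (tree_ends (T_graph xs ys u)) \<and> infinite (tree_ends (T_graph xs ys u))"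
proof
  have "length xs - 1 < length xs" "Suc (length xs - 1) = length xs"
    using k by linarith+
  then have "c (length xs - 1) = letter xs (length xs)"
    unfolding kneading_sequence_def by presburger
  moreover have "\<not> length xs + length ys - 1 < length xs"
      "Suc ((length xs + length ys - 1 - length xs) mod length ys) = length ys"
    using p by (linarith, simp)
  then have "c (length xs + length ys - 1) = letter ys (length ys)"
    unfolding kneading_sequence_def by presburger
  ultimately have "c (length xs - 1) \<noteq> c (length xs + length ys - 1)"
    using last_letters by simp
  then show "countable (tree_ends (T_graph xs ys u))"
    unfolding T_graph_eq
    by (intro cofinal_tree.countable_ends[OF cofinal_tree_T k p] kneading_sequence_periodic)
  show "infinite (tree_ends (T_graph xs ys u))"
    unfolding T_graph_eq by (rule cofinal_tree.infinite_ends[OF cofinal_tree_T])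
qed

end

theorem theorem5p5:
  fixes xs ys :: "int list" and u :: "nat \<Rightarrow> int"
  assumes "length xs \<ge> 1" and "length ys \<ge> 1"
    and "letter xs (length xs) \<noteq> letter ys (length ys)"
  shows "component_of (kneading_schreier_graph xs ys) u = T_graph xs ys u \<and>
    undirected_tree (T_graph xs ys u) \<and>
    countable (tree_ends (T_graph xs ys u)) \<and> infinite (tree_ends (T_graph xs ys u))"
proof (intro conjI)
  show "component_of (kneading_schreier_graph xs ys) u = T_graph xs ys u"
    by (simp only: component_G[OF assms] T_graph_eq[OF assms])
  show "undirected_tree (T_graph xs ys u)"
    unfolding undirected_tree_def T_graph_eq[OF assms]
    using connected_component[OF assms] no_undirected_cycle[OF assms] by blast
qed (use T_graph_ends[OF assms] in simp_all)

end
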